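(* Let $\ell\ge3$. A partition $\lambda$ belongs to the crystal $B(\Lambda_0)^L$ if and only if there does not exist a box $(i,j)\in\lambda$ such that $h^\lambda_{(i,j)}=\ell\cdot\mathrm{arm}(i,j)$.
   Context: For a box $(i,j)$ (row $i$, column $j$) of $\lambda$, $\mathrm{arm}(i,j)$ is the number of boxes of $\lambda$ strictly to its right in row $i$, $\mathrm{leg}(i,j)$ the number of boxes strictly below it in column $j$, and the hook length is $h^\lambda_{(i,j)}=\mathrm{arm}(i,j)+\mathrm{leg}(i,j)+1$. Ladder crystal. The position $(a,b)$ (row $a$, column $b$) has residue $b-a\bmod\ell$. The ladder of $(a,b)$ is the set of positions $(c,d)$, $c,d\ge1$, with $c-a=(\ell-1)(b-d)$; all its positions have the same residue, and it is an $i$-ladder if that residue is $i$. Ladders are ordered left to right, i.e. by increasing value of $a+(\ell-1)(b-1)$. A box of $\lambda$ of residue $i$ whose removal leaves a partition is a removable $i$-box; a position of residue $i$ not in $\lambda$ whose addition gives a partition is an addable $i$-box. Given a partition $\lambda$ and $0\le i<\ell$, label each addable $i$-box $+$ and each removable $i$-box $-$; the ladder $i$-signature is the word read from leftmost $i$-ladder to rightmost $i$-ladder, and from top to bottom on each ladder. Repeatedly cancel adjacent pairs $-+$ to get a word $+\cdots+-\cdots-$. $\widehat f_i\lambda$ is $\lambda$ together with the box of the rightmost remaining $+$ (or $0$ if there is none). The nodes of $B(\Lambda_0)^L$ are the partitions obtained from the empty partition $\emptyset$ by applying finite sequences of the operators $\widehat f_i$, $0\le i<\ell$. *)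

theory Defs
  imports Main "HOL-Library.Confluence"
begin

text \<open>
  Positions are pairs (row, column), both counted from 1, rows going downwards. A partition is
  identified with its Young diagram, the set of its boxes.
\<close>

type_synonym position = "nat \<times> nat"

definition young_diagram :: "nat list \<Rightarrow> position set" where
  "young_diagram xs = {(i, j). 1 \<le> i \<and> i \<le> length xs \<and> 1 \<le> j \<and> j \<le> xs ! (i - 1)}"

definition is_partition :: "position set \<Rightarrow> bool" where
  "is_partition lam \<longleftrightarrow> (\<exists>xs. sorted_wrt (\<ge>) xs \<and> 0 \<notin> set xs \<and> lam = young_diagram xs)"

fun arm :: "position set \<Rightarrow> position \<Rightarrow> nat" where
  "arm lam (i, j) = card {j'. j < j' \<and> (i, j') \<in> lam}"

fun leg :: "position set \<Rightarrow> position \<Rightarrow> nat" where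
  "leg lam (i, j) = card {i'. i < i' \<and> (i', j) \<in> lam}"

definition hook_length :: "position set \<Rightarrow> position \<Rightarrow> nat" where
  "hook_length lam p = arm lam p + leg lam p + 1"

fun residue :: "nat \<Rightarrow> position \<Rightarrow> int" where
  "residue l (a, b) = (int b - int a) mod int l"

fun ladder :: "nat \<Rightarrow> position \<Rightarrow> position set" where
  "ladder l (a, b) =
    {(c, d). 1 \<le> c \<and> 1 \<le> d \<and> int c - int a = (int l - 1) * (int b - int d)}"

text \<open>
  Two positions lie on one ladder exactly when these values agree (\<open>mem_ladder_iff\<close> below); increasing
  values order the ladders from left to right.
\<close>

fun ladder_index :: "nat \<Rightarrow> position \<Rightarrow> int" where
  "ladder_index l (a, b) = int a + (int l - 1) * (int b - 1)"

definition reads_before :: "nat \<Rightarrow> position \<Rightarrow> position \<Rightarrow> bool" where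
  "reads_before l p q \<longleftrightarrow>
    ladder_index l p < ladder_index l q \<or> (q \<in> ladder l p \<and> fst p < fst q)"

definition addable :: "nat \<Rightarrow> nat \<Rightarrow> position set \<Rightarrow> position set" where
  "addable l i lam = {p. p \<notin> lam \<and> residue l p = int i \<and> is_partition (insert p lam)}"

definition removable :: "nat \<Rightarrow> nat \<Rightarrow> position set \<Rightarrow> position set" where
  "removable l i lam = {p \<in> lam. residue l p = int i \<and> is_partition (lam - {p})}"

datatype sign = Plus | Minus

text \<open>Every letter of a signature carries the position it comes from.\<close>

type_synonym signature = "(sign \<times> position) list"

definition reading_list :: "nat \<Rightarrow> nat \<Rightarrow> position set \<Rightarrow> position list" where
  "reading_list l i lam =
    (THE ps. sorted_wrt (reads_before l) ps \<and> set ps = addable l i lam \<union> removable l i lam)"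

definition ladder_signature :: "nat \<Rightarrow> nat \<Rightarrow> position set \<Rightarrow> signature" where
  "ladder_signature l i lam =
    map (\<lambda>p. (if p \<in> addable l i lam then Plus else Minus, p)) (reading_list l i lam)"

inductive cancel :: "signature \<Rightarrow> signature \<Rightarrow> bool" where
  "cancel (u @ (Minus, p) # (Plus, q) # v) (u @ v)"

definition reduced_word :: "signature \<Rightarrow> signature" where
  "reduced_word w = (THE r. cancel\<^sup>*\<^sup>* w r \<and> (\<nexists>r'. cancel r r'))"

text \<open>The value \<open>None\<close> stands for the result 0 of the crystal operator.\<close>

definition f_hat :: "nat \<Rightarrow> nat \<Rightarrow> position set \<Rightarrow> position set option" where
  "f_hat l i lam =
    (let ps = filter (\<lambda>x. fst x = Plus) (reduced_word (ladder_signature l i lam))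
     in if ps = [] then None else Some (insert (snd (last ps)) lam))"

inductive_set ladder_crystal :: "nat \<Rightarrow> position set set" for l :: nat where
  empty: "{} \<in> ladder_crystal l"
| step: "lam \<in> ladder_crystal l \<Longrightarrow> i < l \<Longrightarrow> f_hat l i lam = Some mu \<Longrightarrow> mu \<in> ladder_crystal l"

text \<open>
  The two definite descriptions above are well defined, and \<open>reads_before\<close> is compatible with
  ladders.
\<close>

lemma is_partition_finite: "is_partition lam \<Longrightarrow> finite lam"
proof -
  assume "is_partition lam"
  then obtain xs where xs: "lam = young_diagram xs" by (auto simp: is_partition_def)
  have "young_diagram xs \<subseteq> {..length xs} \<times> {..Max (insert 0 (set xs))}"
  proof (clarsimp simp: young_diagram_def)
    fix a b assume "Suc 0 \<le> a" "a \<le> length xs" "b \<le> xs ! (a - Suc 0)"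
    then have "xs ! (a - Suc 0) \<in> insert 0 (set xs)" by auto
    then have "xs ! (a - Suc 0) \<le> Max (insert 0 (set xs))" by (intro Max_ge) auto
    then show "b \<le> Max (insert 0 (set xs))" using \<open>b \<le> _\<close> by linarith
  qed
  then show ?thesis using xs finite_subset by blast
qed

lemma is_partition_pos: "is_partition lam \<Longrightarrow> (a, b) \<in> lam \<Longrightarrow> 1 \<le> a \<and> 1 \<le> b"
  by (auto simp: is_partition_def young_diagram_def)

lemma mem_ladder_iff:
  assumes "1 \<le> c" "1 \<le> d"
  shows "(c, d) \<in> ladder l (a, b) \<longleftrightarrow> ladder_index l (c, d) = ladder_index l (a, b)"
  using assms by (auto simp: algebra_simps)

lemma residue_ladder: "q \<in> ladder l p \<Longrightarrow> residue l q = residue l p"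
proof (cases p; cases q)
  fix a b c d assume pq: "p = (a, b)" "q = (c, d)" and "q \<in> ladder l p"
  then have "int c - int a = (int l - 1) * (int b - int d)" by simp
  then have "int d - int c = (int b - int a) + int l * (int d - int b)"
    by (simp add: algebra_simps)
  then show ?thesis using pq by simp
qed

lemma ex1_reading_list:
  assumes "2 \<le> l" "finite A" "\<And>a b. (a, b) \<in> A \<Longrightarrow> 1 \<le> a \<and> 1 \<le> b"
  shows "\<exists>!ps. sorted_wrt (reads_before l) ps \<and> set ps = A"
proof -
  define R where "R p q \<longleftrightarrow> ladder_index l p < ladder_index l q
    \<or> (ladder_index l p = ladder_index l q \<and> fst p < fst q)" for p q
  have r: "reads_before l p q \<longleftrightarrow> R p q" if "p \<in> A" "q \<in> A" for p q
    using assms(3) that mem_ladder_iff[of "fst q" "snd q" l "fst p" "snd p"]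
    by (cases p; cases q) (auto simp: reads_before_def R_def)
  have tot: "p = q" if "\<not> R p q" "\<not> R q p" for p q
  proof -
    have "fst p = fst q" "ladder_index l p = ladder_index l q" using that by (auto simp: R_def)
    then show ?thesis using assms(1) by (cases p; cases q) auto
  qed
  have R_asym: "\<not> R q p" if "R p q" for p q using that by (auto simp: R_def)
  have R_trans: "R p s" if "R p q" "R q s" for p q s using that by (auto simp: R_def)
  have ex: "\<exists>ps. sorted_wrt R ps \<and> set ps = B" if "finite B" for B :: "position set"
    using that
  proof (induction rule: finite_induct)
    case empty then show ?case by auto
  next
    case (insert x B)
    then obtain ps where ps: "sorted_wrt R ps" "set ps = B" by auto
    let ?u = "filter (\<lambda>y. R y x) ps" and ?v = "filter (\<lambda>y. R x y) ps"
    have "sorted_wrt R (?u @ x # ?v)"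
      using ps(1) by (auto simp: sorted_wrt_append intro: sorted_wrt_filter R_trans)
    moreover have "set (?u @ x # ?v) = insert x B"
    proof -
      have "R y x \<or> R x y" if "y \<in> B" for y
        using tot[of y x] that insert(2) by blast
      then show ?thesis using ps(2) by auto
    qed
    ultimately show ?case by blast
  qed
  have uniq: "ps = qs" if "sorted_wrt R ps" "sorted_wrt R qs" "set ps = set qs" for ps qs
    using that
  proof (induction ps arbitrary: qs)
    case Nil then show ?case by simp
  next
    case (Cons p ps)
    then obtain q qs' where qs: "qs = q # qs'" by (cases qs) auto
    have pq: "p = q"
    proof (rule ccontr)
      assume "p \<noteq> q"
      then have "p \<in> set qs'" "q \<in> set ps" using Cons.prems(3) qs by auto
      then have "R q p" "R p q" using Cons.prems(1,2) qs by auto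
      then show False using R_asym by blast
    qed
    have "p \<notin> set ps" "p \<notin> set qs'" 
      using Cons.prems(1,2) qs pq R_asym[of q q] by auto
    then have "set ps = set qs'" using Cons.prems(3) qs pq by auto
    then show ?case using Cons.IH[of qs'] Cons.prems qs pq by auto
  qed
  have sw: "sorted_wrt (reads_before l) ps \<longleftrightarrow> sorted_wrt R ps" if "set ps = A" for ps
  proof -
    have "reads_before l (ps ! m) (ps ! n) \<longleftrightarrow> R (ps ! m) (ps ! n)"
      if "m < length ps" "n < length ps" for m n
      using r[of "ps ! m" "ps ! n"] \<open>set ps = A\<close> that nth_mem by blast
    then show ?thesis unfolding sorted_wrt_iff_nth_less by (meson less_trans)
  qed
  obtain ps where "sorted_wrt R ps" "set ps = A" using ex[OF assms(2)] by blast
  then show ?thesis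
    by (intro ex1I[of _ ps]) (auto simp: sw intro: uniq)
qed

lemma reading_list:
  assumes "2 \<le> l" "is_partition lam"
  shows "sorted_wrt (reads_before l) (reading_list l i lam)"
    and "set (reading_list l i lam) = addable l i lam \<union> removable l i lam"
proof -
  let ?A = "addable l i lam \<union> removable l i lam"
  have pos: "1 \<le> a \<and> 1 \<le> b" if "(a, b) \<in> ?A" for a b
    using that is_partition_pos[of "insert (a, b) lam" a b] is_partition_pos[OF assms(2), of a b]
    by (auto simp: addable_def removable_def)
  let ?U = "(\<lambda>(a, b). (Suc a, b)) ` lam \<union> (\<lambda>(a, b). (a, Suc b)) ` lam \<union> {(1, 1)}"
  have "addable l i lam \<subseteq> ?U"
  proof
    fix p assume p: "p \<in> addable l i lam"
    obtain a b where ab: "p = (a, b)" by (cases p)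
    obtain xs where xs: "sorted_wrt (\<ge>) xs" "insert p lam = young_diagram xs"
      using p by (auto simp: addable_def is_partition_def)
    have mem: "(c, d) \<in> insert p lam \<longleftrightarrow> 1 \<le> c \<and> c \<le> length xs \<and> 1 \<le> d \<and> d \<le> xs ! (c - 1)"
      for c d unfolding xs(2) by (simp add: young_diagram_def)
    have m: "1 \<le> a" "a \<le> length xs" "1 \<le> b" "b \<le> xs ! (a - 1)"
      using mem[of a b] ab by auto
    consider "a = 1" "b = 1" | "2 \<le> b" | "2 \<le> a" using m by linarith
    then show "p \<in> ?U"
    proof cases
      case 1 then show ?thesis using ab by simp
    next
      case 2
      then have "(a, b - 1) \<in> insert p lam" using m by (subst mem) linarith
      then have "(a, b - 1) \<in> lam" using ab 2 by auto
      moreover have "p = (\<lambda>(a, b). (a, Suc b)) (a, b - 1)" using ab 2 by simp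
      ultimately show ?thesis by blast
    next
      case 3
      have "xs ! (a - 1) \<le> xs ! (a - 2)"
        using sorted_wrt_nth_less[OF xs(1), of "a - 2" "a - 1"] m 3 by simp
      moreover have "a - 1 - 1 = a - 2" by simp
      ultimately have "(a - 1, b) \<in> insert p lam" using m 3 by (subst mem) auto
      then have "(a - 1, b) \<in> lam" using ab 3 by auto
      moreover have "p = (\<lambda>(a, b). (Suc a, b)) (a - 1, b)" using ab 3 by simp
      ultimately show ?thesis by blast
    qed
  qed
  then have "finite (addable l i lam)"
    using is_partition_finite[OF assms(2)] finite_subset by blast
  moreover have "finite (removable l i lam)"
    using is_partition_finite[OF assms(2)] by (auto simp: removable_def)
  ultimately have "\<exists>!ps. sorted_wrt (reads_before l) ps \<and> set ps = ?A"
    using ex1_reading_list[OF assms(1)] pos by (metis finite_Un)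
  from theI'[OF this]
  show "sorted_wrt (reads_before l) (reading_list l i lam)"
    and "set (reading_list l i lam) = ?A"
    by (auto simp: reading_list_def)
qed

lemma cancel_diamond:
  assumes "cancel w x" "cancel w y" "x \<noteq> y"
  shows "\<exists>z. cancel x z \<and> cancel y z"
proof -
  have main: "\<exists>z. cancel (u @ v) z \<and> cancel (u' @ v') z"
    if eq: "u @ (Minus, p) # (Plus, q) # v = u' @ (Minus, p') # (Plus, q') # v'"
      and len: "length u < length u'" for u v p q u' v' p' q'
  proof -
    obtain us where us: "u' = u @ us" "us \<noteq> []"
      using eq len by (auto simp: append_eq_append_conv2)
    then have "(Minus, p) # (Plus, q) # v = us @ (Minus, p') # (Plus, q') # v'"
      using eq by simp
    then obtain us' where us': "us = (Minus, p) # (Plus, q) # us'"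
        "v = us' @ (Minus, p') # (Plus, q') # v'"
      using us(2) by (auto simp: Cons_eq_append_conv)
    have "cancel (u @ v) (u @ us' @ v')"
      using cancel.intros[of "u @ us'" p' q' v'] us' by simp
    moreover have "cancel (u' @ v') (u @ us' @ v')"
      using cancel.intros[of u p q "us' @ v'"] us us' by simp
    ultimately show ?thesis by blast
  qed
  obtain u p q v where 1: "w = u @ (Minus, p) # (Plus, q) # v" "x = u @ v"
    using assms(1) by (auto elim: cancel.cases)
  obtain u' p' q' v' where 2: "w = u' @ (Minus, p') # (Plus, q') # v'" "y = u' @ v'"
    using assms(2) by (auto elim: cancel.cases)
  have "length u \<noteq> length u'" using 1 2 assms(3) by auto
  then consider "length u < length u'" | "length u' < length u" by linarith
  then show ?thesis
    by cases (use main[of u p q v u' p' q' v'] main[of u' p' q' v' u p q v] 1 2 in auto)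
qed

lemma reduced_word: "cancel\<^sup>*\<^sup>* w (reduced_word w) \<and> (\<nexists>r'. cancel (reduced_word w) r')"
proof -
  have ex: "\<exists>r. cancel\<^sup>*\<^sup>* w r \<and> (\<nexists>r'. cancel r r')"
  proof (induction w rule: length_induct)
    case (1 w)
    show ?case
    proof (cases "\<exists>w'. cancel w w'")
      case True
      then obtain w' where w': "cancel w w'" by auto
      then have "length w' < length w" by (auto elim: cancel.cases)
      then show ?thesis using 1 w' by (meson converse_rtranclp_into_rtranclp)
    qed auto
  qed
  have "strong_confluentp cancel"
    unfolding strong_confluentp_def using cancel_diamond by blast
  then have c: "confluentp cancel" by (rule strong_confluentp_imp_confluentp)
  have "r = s" if h: "cancel\<^sup>*\<^sup>* w r" "\<nexists>r'. cancel r r'" "cancel\<^sup>*\<^sup>* w s" "\<nexists>s'. cancel s s'" for r s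
  proof -
    obtain t where "cancel\<^sup>*\<^sup>* r t" "cancel\<^sup>*\<^sup>* s t" using confluentpD[OF c h(1,3)] by blast
    then show ?thesis using h by (metis converse_rtranclpE)
  qed
  then have "\<exists>!r. cancel\<^sup>*\<^sup>* w r \<and> (\<nexists>r'. cancel r r')" using ex by blast
  from theI'[OF this] show ?thesis by (simp add: reduced_word_def)
qed

end

theory Submission
  imports Defs
begin

text \<open>
  The hook condition says that no ladder carries the last box of a row above a vacant position whose
  upper neighbour is a box. If adding the box of the rightmost uncancelled plus created such a pair,
  then either a pair of this kind was there before, or there would be a further addable box whose plus
  can only be cancelled by a removable box that again lies in such a pair. Hence the condition is
  preserved by the crystal operators and, symmetrically, by their inverses. In a nonempty partition
  satisfying it, a box on the rightmost occupied ladder gives a minus that is never cancelled, so an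
  inverse operator applies, and induction on the size leads down to the empty partition.
\<close>

section \<open>Partitions as finite order ideals; local tests for addable and removable
  boxes\<close>

text \<open>This trades the list encoding for a closure property that is easy to check after adding
  or removing one box. The rows and the first column are initial segments of the positive integers,
  and the row lengths form the required list.\<close>

lemma is_partitionI:
  assumes fin: "finite lam" and pos: "\<And>a b. (a, b) \<in> lam \<Longrightarrow> 1 \<le> a \<and> 1 \<le> b"
    and down: "\<And>a b c d. (a, b) \<in> lam \<Longrightarrow> 1 \<le> c \<Longrightarrow> c \<le> a \<Longrightarrow> 1 \<le> d \<Longrightarrow> d \<le> b \<Longrightarrow> (c, d) \<in> lam"
  shows "is_partition lam"
proof -
  define r where "r a = card {b. (a, b) \<in> lam}" for a
  define n where "n = card {a. (a, 1) \<in> lam}"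
  have initial: "S = {1..card S}"
    if "finite S" "\<And>x. x \<in> S \<Longrightarrow> 1 \<le> x" "\<And>x y. x \<in> S \<Longrightarrow> 1 \<le> y \<Longrightarrow> y \<le> x \<Longrightarrow> y \<in> S" for S :: "nat set"
  proof (cases "S = {}")
    case False
    define M where "M = Max S"
    have M: "M \<in> S" "\<And>x. x \<in> S \<Longrightarrow> x \<le> M"
      unfolding M_def by (rule Max_in[OF that(1) False], rule Max_ge[OF that(1)])
    have "S = {1..M}"
    proof (rule set_eqI)
      show "x \<in> S \<longleftrightarrow> x \<in> {1..M}" for x using M(2)[of x] that(2)[of x] that(3)[OF M(1), of x] by auto
    qed
    then show ?thesis by simp
  qed simp
  have fin_row: "finite {b. (a, b) \<in> lam}" for a
    by (rule finite_subset[OF _ finite_imageI[OF fin, of snd]]) force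
  have fin_col: "finite {a. (a, 1) \<in> lam}"
    by (rule finite_subset[OF _ finite_imageI[OF fin, of fst]]) force
  have row: "{b. (a, b) \<in> lam} = {1..r a}" for a
    unfolding r_def
  proof (rule initial[OF fin_row])
    show "1 \<le> x" if "x \<in> {b. (a, b) \<in> lam}" for x using that pos by blast
    show "y \<in> {b. (a, b) \<in> lam}" if "x \<in> {b. (a, b) \<in> lam}" "1 \<le> y" "y \<le> x" for x y
      using that down[of a x a y] pos[of a x] by simp
  qed
  have col: "{a. (a, 1) \<in> lam} = {1..n}"
    unfolding n_def
  proof (rule initial[OF fin_col])
    show "1 \<le> x" if "x \<in> {a. (a, 1) \<in> lam}" for x using that pos by blast
    show "y \<in> {a. (a, 1) \<in> lam}" if "x \<in> {a. (a, 1) \<in> lam}" "1 \<le> y" "y \<le> x" for x y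
      using that down[of x 1 y 1] by simp
  qed
  have mem: "(a, b) \<in> lam \<longleftrightarrow> 1 \<le> b \<and> b \<le> r a" for a b
    using row[of a] by (simp add: set_eq_iff)
  have len: "1 \<le> r a \<longleftrightarrow> 1 \<le> a \<and> a \<le> n" for a
    using col mem[of a 1] by (simp add: set_eq_iff)
  have mono: "r a \<le> r c" if "1 \<le> c" "c \<le> a" for a c
  proof (cases "r a = 0")
    case False
    then have "(a, r a) \<in> lam" unfolding mem by simp
    then have "(c, r a) \<in> lam" using down[of a "r a" c "r a"] that False by simp
    then show ?thesis unfolding mem by simp
  qed simp
  \<comment> \<open>Rows are listed only down to the length \<open>n\<close> of the first column,
    which excludes zero entries; index \<open>a - 1\<close> holds row \<open>a\<close>.\<close>
  define xs where "xs = map r [1..<Suc n]"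
  have "sorted_wrt (\<ge>) xs"
    unfolding xs_def sorted_wrt_iff_nth_less using mono by (auto simp del: upt_Suc)
  moreover have "0 \<notin> set xs"
  proof
    assume "0 \<in> set xs"
    then obtain a where "1 \<le> a" "a \<le> n" "r a = 0" by (auto simp: xs_def simp del: upt_Suc)
    then show False using len[of a] by simp
  qed
  moreover have "lam = young_diagram xs"
  proof (rule set_eqI, clarify)
    fix a b
    have "xs ! (a - 1) = r a" if "1 \<le> a" "a \<le> n" using that by (simp add: xs_def del: upt_Suc)
    moreover have "length xs = n" by (simp add: xs_def)
    ultimately show "(a, b) \<in> lam \<longleftrightarrow> (a, b) \<in> young_diagram xs"
      using mem[of a b] len[of a] by (auto simp: young_diagram_def)
  qed
  ultimately show ?thesis unfolding is_partition_def by blast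
qed

lemma is_partition_down:
  assumes "is_partition lam" "(a, b) \<in> lam" "1 \<le> c" "c \<le> a" "1 \<le> d" "d \<le> b"
  shows "(c, d) \<in> lam"
proof -
  obtain xs where xs: "sorted_wrt (\<ge>) xs" "lam = young_diagram xs"
    using assms(1) by (auto simp: is_partition_def)
  have m: "a \<le> length xs" "b \<le> xs ! (a - 1)"
    using assms(2) by (auto simp: xs(2) young_diagram_def)
  have "xs ! (a - 1) \<le> xs ! (c - 1)"
  proof (cases "c = a")
    case False
    then have "c - 1 < a - 1" "a - 1 < length xs" using assms(3,4) m by linarith+
    then show ?thesis using sorted_wrt_nth_less[OF xs(1)] by blast
  qed simp
  then show ?thesis using assms(3-6) m by (simp add: xs(2) young_diagram_def)
qed

lemma is_partition_empty: "is_partition {}"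
  by (rule is_partitionI) auto

text \<open>Every other position weakly above and left of \<open>(a, b)\<close> is weakly above and
  left of \<open>(a - 1, b)\<close> or \<open>(a, b - 1)\<close>, so two neighbours decide.
  \<open>a = 1\<close> and \<open>b = 1\<close> stand for a neighbour outside the quadrant.\<close>

lemma mem_addable_iff:
  assumes "is_partition lam"
  shows "(a, b) \<in> addable l i lam \<longleftrightarrow> residue l (a, b) = int i \<and> (a, b) \<notin> lam \<and> 1 \<le> a \<and> 1 \<le> b \<and>
    (a = 1 \<or> (a - 1, b) \<in> lam) \<and> (b = 1 \<or> (a, b - 1) \<in> lam)" (is "_ \<longleftrightarrow> ?R")
proof
  assume L: "(a, b) \<in> addable l i lam"
  then have p: "is_partition (insert (a, b) lam)" by (simp add: addable_def)
  have pos: "1 \<le> a" "1 \<le> b" using is_partition_pos[OF p] by blast+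
  have "(a - 1, b) \<in> lam" if "a \<noteq> 1"
    using is_partition_down[OF p, of a b "a - 1" b] that pos by (cases a) auto
  moreover have "(a, b - 1) \<in> lam" if "b \<noteq> 1"
    using is_partition_down[OF p, of a b a "b - 1"] that pos by (cases b) auto
  ultimately show ?R using L pos unfolding addable_def mem_Collect_eq by blast
next
  assume R: ?R
  have "is_partition (insert (a, b) lam)"
  proof (rule is_partitionI)
    show "finite (insert (a, b) lam)" using is_partition_finite[OF assms] by simp
    show "1 \<le> a' \<and> 1 \<le> b'" if "(a', b') \<in> insert (a, b) lam" for a' b'
      using that R is_partition_pos[OF assms] by blast
    fix a' b' c d assume h: "(a', b') \<in> insert (a, b) lam" "1 \<le> c" "c \<le> a'" "1 \<le> d" "d \<le> b'"
    show "(c, d) \<in> insert (a, b) lam"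
    proof (cases "(a', b') \<in> lam")
      case True then show ?thesis using is_partition_down[OF assms] h by blast
    next
      case False
      then have e: "a' = a" "b' = b" using h by auto
      consider "c = a \<and> d = b" | "c < a" | "d < b" using h e by linarith
      then show ?thesis
      proof cases
        case 2
        then show ?thesis using R h e is_partition_down[OF assms, of "a - 1" b c d] by fastforce
      next
        case 3
        then show ?thesis using R h e is_partition_down[OF assms, of a "b - 1" c d] by fastforce
      qed simp
    qed
  qed
  then show "(a, b) \<in> addable l i lam" using R by (simp add: addable_def)
qed

lemma mem_removable_iff:
  assumes "is_partition lam"
  shows "(a, b) \<in> removable l i lam \<longleftrightarrow> residue l (a, b) = int i \<and> (a, b) \<in> lam \<and>
    (Suc a, b) \<notin> lam \<and> (a, Suc b) \<notin> lam" (is "_ \<longleftrightarrow> ?R")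
proof
  assume L: "(a, b) \<in> removable l i lam"
  then have p: "is_partition (lam - {(a, b)})" and m: "(a, b) \<in> lam" by (auto simp: removable_def)
  have "1 \<le> a \<and> 1 \<le> b" using is_partition_pos[OF assms m] .
  then show ?R using L is_partition_down[OF p, of "Suc a" b a b] is_partition_down[OF p, of a "Suc b" a b]
    by (auto simp: removable_def simp del: residue.simps)
next
  assume R: ?R
  have "is_partition (lam - {(a, b)})"
  proof (rule is_partitionI)
    show "finite (lam - {(a, b)})" using is_partition_finite[OF assms] by simp
    show "1 \<le> a' \<and> 1 \<le> b'" if "(a', b') \<in> lam - {(a, b)}" for a' b'
      using that is_partition_pos[OF assms] by blast
    fix a' b' c d assume h: "(a', b') \<in> lam - {(a, b)}" "1 \<le> c" "c \<le> a'" "1 \<le> d" "d \<le> b'"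
    have "(c, d) \<noteq> (a, b)"
    proof
      assume "(c, d) = (a, b)"
      then have "(Suc a \<le> a' \<and> b \<le> b') \<or> (a \<le> a' \<and> Suc b \<le> b')" using h by auto
      then show False
        using R h \<open>(c, d) = (a, b)\<close> is_partition_down[OF assms, of a' b' "Suc a" b]
          is_partition_down[OF assms, of a' b' a "Suc b"] by auto
    qed
    then show "(c, d) \<in> lam - {(a, b)}" using is_partition_down[OF assms, of a' b' c d] h by auto
  qed
  then show "(a, b) \<in> removable l i lam" using R by (simp add: removable_def)
qed

section \<open>Hook lengths expressed through ladders\<close>

text \<open>
  A box with \<open>arm = k\<close> and \<open>leg + 1 = (l - 1) * k\<close> has the end of its row and the position just
  below its column on a common ladder, so excluding such boxes is a condition on ladders.
\<close>

definition ladder_free :: "nat \<Rightarrow> position set \<Rightarrow> bool" where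
  "ladder_free l lam \<longleftrightarrow> (\<forall>a b c d. (a, b) \<in> lam \<longrightarrow> (a, Suc b) \<notin> lam \<longrightarrow> (c, d) \<in> lam \<longrightarrow>
    (Suc c, d) \<notin> lam \<longrightarrow> ladder_index l (a, b) = ladder_index l (Suc c, d) \<longrightarrow> c < a)"

lemma ladder_freeD:
  assumes "ladder_free l lam" "(a, b) \<in> lam" "(a, Suc b) \<notin> lam" "(c, d) \<in> lam" "(Suc c, d) \<notin> lam"
    "ladder_index l (a, b) = ladder_index l (Suc c, d)"
  shows "c < a"
  using assms unfolding ladder_free_def by blast

text \<open>Arms and legs are both counted by this: a downward closed condition that ends at
  \<open>j + k\<close> cuts out the interval \<open>{j<..j + k}\<close>.\<close>

lemma card_run:
  fixes P :: "nat \<Rightarrow> bool"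
  assumes "\<And>m n. P n \<Longrightarrow> j \<le> m \<Longrightarrow> m \<le> n \<Longrightarrow> P m" "P (j + k)" "\<not> P (Suc (j + k))"
  shows "card {n. j < n \<and> P n} = k"
proof -
  have "{n. j < n \<and> P n} = {j<..j + k}"
  proof (rule set_eqI)
    fix n
    have "P n" if "j < n" "n \<le> j + k" using assms(1)[OF assms(2), of n] that by linarith
    moreover have "n \<le> j + k" if "P n" using assms(1)[OF that, of "Suc (j + k)"] assms(3) by linarith
    ultimately show "n \<in> {n. j < n \<and> P n} \<longleftrightarrow> n \<in> {j<..j + k}" by auto
  qed
  then show ?thesis by simp
qed

lemma run_end:
  fixes P :: "nat \<Rightarrow> bool"
  assumes "finite {n. P n}" "\<And>m n. P n \<Longrightarrow> j \<le> m \<Longrightarrow> m \<le> n \<Longrightarrow> P m" "P j"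
  shows "\<exists>k. P (j + k) \<and> \<not> P (Suc (j + k))"
proof -
  let ?M = "Max {n. P n}"
  have "P ?M" using Max_in[OF assms(1)] assms(3) by auto
  moreover have "j \<le> ?M" using assms(1,3) by simp
  moreover have "\<not> P (Suc ?M)" using Max_ge[OF assms(1), of "Suc ?M"] by auto
  ultimately show ?thesis by (intro exI[of _ "?M - j"]) simp
qed

lemma arm_eq:
  assumes "is_partition lam" "1 \<le> j" "(i, j + k) \<in> lam" "(i, Suc (j + k)) \<notin> lam"
  shows "arm lam (i, j) = k"
  unfolding arm.simps
proof (rule card_run)
  fix m n assume h: "(i, n) \<in> lam" "j \<le> m" "m \<le> n"
  show "(i, m) \<in> lam"
    by (rule is_partition_down[OF assms(1) h(1)])
      (use h assms(2) is_partition_pos[OF assms(1) h(1)] in auto)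
qed fact+

lemma leg_eq:
  assumes "is_partition lam" "1 \<le> i" "(i + k, j) \<in> lam" "(Suc (i + k), j) \<notin> lam"
  shows "leg lam (i, j) = k"
  unfolding leg.simps
proof (rule card_run)
  fix m n assume h: "(n, j) \<in> lam" "i \<le> m" "m \<le> n"
  show "(m, j) \<in> lam"
    by (rule is_partition_down[OF assms(1) h(1)])
      (use h assms(2) is_partition_pos[OF assms(1) h(1)] in auto)
qed fact+

lemma row_end:
  assumes "is_partition lam" "(i, j) \<in> lam"
  shows "\<exists>k. (i, j + k) \<in> lam \<and> (i, Suc (j + k)) \<notin> lam"
proof (rule run_end)
  show "finite {n. (i, n) \<in> lam}"
    by (rule finite_subset[OF _ finite_imageI[OF is_partition_finite[OF assms(1)], of snd]]) force
  fix m n assume h: "(i, n) \<in> lam" "j \<le> m" "m \<le> n"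
  show "(i, m) \<in> lam"
    by (rule is_partition_down[OF assms(1) h(1)])
      (use h is_partition_pos[OF assms] is_partition_pos[OF assms(1) h(1)] in auto)
qed fact

lemma column_end:
  assumes "is_partition lam" "(i, j) \<in> lam"
  shows "\<exists>k. (i + k, j) \<in> lam \<and> (Suc (i + k), j) \<notin> lam"
proof (rule run_end)
  show "finite {n. (n, j) \<in> lam}"
    by (rule finite_subset[OF _ finite_imageI[OF is_partition_finite[OF assms(1)], of fst]]) force
  fix m n assume h: "(n, j) \<in> lam" "i \<le> m" "m \<le> n"
  show "(m, j) \<in> lam"
    by (rule is_partition_down[OF assms(1) h(1)])
      (use h is_partition_pos[OF assms] is_partition_pos[OF assms(1) h(1)] in auto)
qed fact

text \<open>With arm \<open>k\<close> and leg \<open>r\<close> the hook equation reads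
  \<open>r + 1 = (l - 1) * k\<close>: going from the row end \<open>k\<close> columns left and
  \<open>r + 1\<close> rows down stays on the ladder. Conversely, a forbidden pair on a ladder spans
  a hook whose corner box satisfies the equation.\<close>

lemma ladder_free_iff_hook:
  assumes "2 \<le> l" and p: "is_partition lam"
  shows "ladder_free l lam \<longleftrightarrow> \<not> (\<exists>(i, j) \<in> lam. hook_length lam (i, j) = l * arm lam (i, j))"
proof
  assume free: "ladder_free l lam"
  show "\<not> (\<exists>(i, j) \<in> lam. hook_length lam (i, j) = l * arm lam (i, j))"
  proof clarify
    fix i j assume ij: "(i, j) \<in> lam" and hook: "hook_length lam (i, j) = l * arm lam (i, j)"
    obtain k where k: "(i, j + k) \<in> lam" "(i, Suc (j + k)) \<notin> lam" using row_end[OF p ij] by blast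
    obtain r where r: "(i + r, j) \<in> lam" "(Suc (i + r), j) \<notin> lam" using column_end[OF p ij] by blast
    have "k + r + 1 = l * k"
      using hook arm_eq[OF p _ k] leg_eq[OF p _ r] is_partition_pos[OF p ij]
      by (simp add: hook_length_def)
    then have "int k + int r + 1 = int l * int k" by (metis of_nat_1 of_nat_add of_nat_mult)
    then have "ladder_index l (i, j + k) = ladder_index l (Suc (i + r), j)"
      by (simp add: algebra_simps)
    then show False using ladder_freeD[OF free k r] by simp
  qed
next
  assume H: "\<not> (\<exists>(i, j) \<in> lam. hook_length lam (i, j) = l * arm lam (i, j))"
  show "ladder_free l lam" unfolding ladder_free_def
  proof (intro allI impI, rule ccontr)
    fix a b c d
    assume h: "(a, b) \<in> lam" "(a, Suc b) \<notin> lam" "(c, d) \<in> lam" "(Suc c, d) \<notin> lam"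
      and idx: "ladder_index l (a, b) = ladder_index l (Suc c, d)" and "\<not> c < a"
    have pos: "1 \<le> a" "1 \<le> d" using is_partition_pos[OF p] h by auto
    have eq: "(int l - 1) * (int b - int d) = int c + 1 - int a"
      using idx by (simp add: algebra_simps)
    \<comment> \<open>As \<open>a\<close> is at most \<open>c\<close>, the ladder equation puts
      column \<open>d\<close> strictly left of \<open>b\<close>. The hook at \<open>(a, d)\<close>
      then has arm \<open>b - d\<close> and leg \<open>c - a\<close>.\<close>
    then have "0 < (int l - 1) * (int b - int d)" using \<open>\<not> c < a\<close> by simp
    then have "d < b" using assms(1) by (simp add: zero_less_mult_iff)
    define k where "k = b - d"
    define r where "r = c - a"
    have b: "b = d + k" and c: "c = a + r" using \<open>d < b\<close> \<open>\<not> c < a\<close> by (auto simp: k_def r_def)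
    have "(a, d) \<in> lam" using is_partition_down[OF p h(1)] pos b by simp
    moreover have "int (k + r + 1) = int (l * k)" using eq by (simp add: b c algebra_simps)
    then have "k + r + 1 = l * k" by (rule of_nat_eq_iff[THEN iffD1])
    then have "hook_length lam (a, d) = l * arm lam (a, d)"
      using arm_eq[OF p, of d a k] leg_eq[OF p, of a r d] h pos by (simp add: hook_length_def b c)
    ultimately show False using H by blast
  qed
qed

section \<open>Residues, ladder indices and the reading order\<close>

text \<open>The index of \<open>(a, b)\<close> is \<open>1 - (b - a) + l * (b - 1)\<close>, so
  modulo \<open>l\<close> it is one minus the content.\<close>

lemma residue_eq_iff: "residue l p = residue l q \<longleftrightarrow> int l dvd ladder_index l q - ladder_index l p"
proof -
  obtain a b c d where pq: "p = (a, b)" "q = (c, d)" by (cases p; cases q)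
  have "ladder_index l q - ladder_index l p =
      ((int b - int a) - (int d - int c)) + int l * (int d - int b)"
    by (simp add: pq algebra_simps)
  then have "int l dvd ladder_index l q - ladder_index l p \<longleftrightarrow> int l dvd (int b - int a) - (int d - int c)"
    using dvd_add_left_iff[of "int l" "int l * (int d - int b)"] by (metis dvd_triv_left)
  then show ?thesis by (simp add: pq mod_eq_dvd_iff del: ladder_index.simps)
qed

text \<open>The indices differ by a multiple of \<open>l\<close>. Later this confines a letter read
  between two consecutive ladders of its residue to one of these two.\<close>

lemma ladder_index_cases:
  assumes "residue l p = residue l q" "ladder_index l p \<le> ladder_index l q"
    "ladder_index l q \<le> ladder_index l p + int l"
  shows "ladder_index l q = ladder_index l p \<or> ladder_index l q = ladder_index l p + int l"
proof -
  obtain t where t: "ladder_index l q - ladder_index l p = int l * t"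
    using assms(1) unfolding residue_eq_iff by blast
  show ?thesis
  proof (cases "l = 0")
    case False
    have "int l * 0 \<le> int l * t" "int l * t \<le> int l * 1" using assms(2,3) t by linarith+
    then have "0 \<le> t" "t \<le> 1" using False by (auto simp only: mult_le_cancel_left_pos of_nat_0_less_iff)
    then have "t = 0 \<or> t = 1" by linarith
    then show ?thesis using t by auto
  qed (use assms in auto)
qed

lemma ladder_index_Suc:
  "ladder_index l (Suc a, b) = ladder_index l (a, b) + 1"
  "ladder_index l (a, Suc b) = ladder_index l (a, b) + int l - 1"
  by (auto simp: algebra_simps)

text \<open>The index changes by \<open>1\<close> or \<open>l - 1\<close>, neither of them divisible
  by \<open>l\<close>. Hence a box never influences the status of another position of its own
  residue.\<close>

lemma residue_Suc_neq:
  assumes "2 \<le> l"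
  shows "residue l (Suc a, b) \<noteq> residue l (a, b)" "residue l (a, Suc b) \<noteq> residue l (a, b)"
proof -
  have n: "\<not> int l dvd 1" using assms by simp
  then show "residue l (Suc a, b) \<noteq> residue l (a, b)"
    unfolding residue_eq_iff ladder_index_Suc by simp
  have "int l dvd 1" if "int l dvd ladder_index l (a, b) - (ladder_index l (a, b) + int l - 1)"
    using dvd_add[OF that dvd_refl] by (simp del: ladder_index.simps)
  then show "residue l (a, Suc b) \<noteq> residue l (a, b)"
    unfolding residue_eq_iff ladder_index_Suc using n by blast
qed

lemma reads_beforeD:
  assumes "reads_before l p q"
  shows "ladder_index l p < ladder_index l q \<or> ladder_index l p = ladder_index l q \<and> fst p < fst q"
  using assms by (cases p; cases q) (auto simp: reads_before_def algebra_simps)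

lemma reads_beforeI:
  assumes "1 \<le> fst q" "1 \<le> snd q"
    and "ladder_index l p < ladder_index l q \<or> ladder_index l p = ladder_index l q \<and> fst p < fst q"
  shows "reads_before l p q"
  using assms mem_ladder_iff[of "fst q" "snd q" l "fst p" "snd p"]
  by (auto simp: reads_before_def simp del: ladder_index.simps ladder.simps)

lemma reads_before_asym: "reads_before l p q \<Longrightarrow> \<not> reads_before l q p"
  using reads_beforeD[of l p q] reads_beforeD[of l q p] by linarith

section \<open>Preservation of the ladder condition when one box is added or removed\<close>

text \<open>\<open>between\<close> is what the rightmost surviving plus satisfies. A forbidden pair
  consists of a row end \<open>(r, s)\<close> and a vacancy \<open>(Suc c, d)\<close> below a box.
  If the new box takes part in it, either the pair moved by one step is already forbidden in
  \<open>lam\<close>, or there is a later addable position and the removable box supplied by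
  \<open>between\<close> lies in a forbidden pair of \<open>lam\<close>.\<close>

lemma ladder_free_insert:
  assumes l: "2 \<le> l" and p: "is_partition lam" and free: "ladder_free l lam"
    and x: "(a, b) \<in> addable l i lam"
    and between: "\<And>q. q \<in> addable l i lam \<Longrightarrow> reads_before l (a, b) q \<Longrightarrow>
      \<exists>y \<in> removable l i lam. reads_before l (a, b) y \<and> reads_before l y q"
  shows "ladder_free l (insert (a, b) lam)"
  unfolding ladder_free_def
proof (intro allI impI, rule ccontr)
  fix r s c d
  assume rs: "(r, s) \<in> insert (a, b) lam" "(r, Suc s) \<notin> insert (a, b) lam"
    and cd: "(c, d) \<in> insert (a, b) lam" "(Suc c, d) \<notin> insert (a, b) lam"
    and idx: "ladder_index l (r, s) = ladder_index l (Suc c, d)" and "\<not> c < r"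
  then have rc: "r \<le> c" by simp
  note xD = x[unfolded mem_addable_iff[OF p]]
  note idx' = idx[unfolded ladder_index_Suc]
  note freeD = ladder_freeD[OF free, unfolded ladder_index_Suc]
  consider "(r, s) = (a, b)" "(c, d) = (a, b)" | "(r, s) = (a, b)" "(c, d) \<in> lam"
    | "(r, s) \<in> lam" "(c, d) \<in> lam" | "(r, s) \<in> lam" "(c, d) = (a, b)"
    using rs(1) cd(1) by blast
  then show False
  proof cases
    case 1
    then show False using idx' by (simp del: ladder_index.simps)
  next
    case 2
    then have ab: "a = r" "b = s" by auto
    have pos: "1 \<le> c" "1 \<le> d" using is_partition_pos[OF p 2(2)] by auto
    show False
    \<comment> \<open>If the vacancy has no left neighbour or a box there, it is addable. The
      removable box from \<open>between\<close> is then squeezed onto the same ladder above row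
      \<open>Suc c\<close>, and as a row end it is forbidden together with
      \<open>(c, d)\<close>.\<close>
    proof (cases "d = 1 \<or> (Suc c, d - 1) \<in> lam")
      case True
      have "residue l (a, b) = residue l (Suc c, d)" unfolding residue_eq_iff using idx ab by simp
      then have "(Suc c, d) \<in> addable l i lam"
        unfolding mem_addable_iff[OF p] using True 2(2) cd(2) pos xD by auto
      moreover have "reads_before l (a, b) (Suc c, d)"
        by (rule reads_beforeI) (use idx ab rc pos in \<open>auto simp del: ladder_index.simps\<close>)
      ultimately obtain e f where y: "(e, f) \<in> removable l i lam" "reads_before l (a, b) (e, f)"
        "reads_before l (e, f) (Suc c, d)" using between by fastforce
      have "ladder_index l (e, f) = ladder_index l (a, b)" "e < Suc c"
        using reads_beforeD[OF y(2)] reads_beforeD[OF y(3)] idx ab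
        by (auto simp del: ladder_index.simps)
      moreover have "(e, f) \<in> lam" "(e, Suc f) \<notin> lam" using y(1) unfolding mem_removable_iff[OF p] by auto
      ultimately show False using freeD[of e f c d] 2(2) cd(2) idx' ab by (simp del: ladder_index.simps)
    next
      \<comment> \<open>Here the pair moves one column left: \<open>(a, b - 1)\<close> ends its row
        in \<open>lam\<close>, \<open>(Suc c, d - 1)\<close> is vacant, and both indices drop by
        \<open>l - 1\<close>.\<close>
      case False
      then obtain d' where d': "d = Suc d'" "1 \<le> d'" using pos by (cases d) auto
      \<comment> \<open>In column 1 the index is the row number, so \<open>b = 1\<close> would force
        \<open>a\<close> to be at least \<open>c + 1\<close>.\<close>
      have b1: "b \<noteq> 1"
      proof
        assume "b = 1"
        then have "int a = int c + 1 + (int l - 1) * (int d - 1)" using idx ab by simp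
        moreover have "0 \<le> (int l - 1) * (int d - 1)" using l pos by simp
        ultimately show False using rc ab by simp
      qed
      then obtain b' where b': "b = Suc b'" using xD by (cases b) auto
      have "(a, b') \<in> lam" using xD b1 b' by simp
      moreover have "(a, Suc b') \<notin> lam" using xD b' by simp
      moreover have "(c, d') \<in> lam" using is_partition_down[OF p 2(2), of c d'] pos d' by simp
      moreover have "(Suc c, d') \<notin> lam" using False d' by simp
      moreover have "ladder_index l (a, b') = ladder_index l (c, d') + 1"
        using idx unfolding ab(1)[symmetric] ab(2)[symmetric] b' d' ladder_index_Suc by simp
      ultimately show False using freeD[of a b' c d'] rc ab by simp
    qed
  next
    case 3
    then show False using freeD[of r s c d] rs cd idx' rc by simp
  next
    case 4
    then have ab: "a = c" "b = d" by auto
    have pos: "1 \<le> r" "1 \<le> s" using is_partition_pos[OF p 4(1)] by auto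
    have rs': "(r, Suc s) \<notin> lam" using rs by blast
    show False
    \<comment> \<open>Now the new box is the one above the vacancy, and \<open>(r, Suc s)\<close>
      lies on the next ladder of residue \<open>i\<close>. If it is addable, the removable box in
      between is either on the ladder of the new box, where it is forbidden with
      \<open>(r, s)\<close>, or on the next one, where it is forbidden with
      \<open>(r - 1, Suc s)\<close>.\<close>
    proof (cases "r = 1 \<or> (r - 1, Suc s) \<in> lam")
      case True
      have up: "ladder_index l (r, Suc s) = ladder_index l (a, b) + int l"
        using idx' ab unfolding ladder_index_Suc by simp
      then have res: "residue l (a, b) = residue l (r, Suc s)" unfolding residue_eq_iff by simp
      then have "(r, Suc s) \<in> addable l i lam"
        unfolding mem_addable_iff[OF p] using True 4(1) rs' pos xD by auto
      moreover have "reads_before l (a, b) (r, Suc s)"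
        by (rule reads_beforeI) (use up pos l in \<open>auto simp del: ladder_index.simps\<close>)
      ultimately obtain e f where y: "(e, f) \<in> removable l i lam" "reads_before l (a, b) (e, f)"
        "reads_before l (e, f) (r, Suc s)" using between by fastforce
      have ef: "(e, f) \<in> lam" "(e, Suc f) \<notin> lam" "(Suc e, f) \<notin> lam" "residue l (a, b) = residue l (e, f)"
        using y(1) xD unfolding mem_removable_iff[OF p] by auto
      have "ladder_index l (e, f) = ladder_index l (a, b) \<or>
          ladder_index l (e, f) = ladder_index l (a, b) + int l"
        by (rule ladder_index_cases[OF ef(4)]) (use reads_beforeD[OF y(2)] reads_beforeD[OF y(3)] up in linarith)+
      then show False
      proof
        assume e: "ladder_index l (e, f) = ladder_index l (a, b)"
        then have "a < e" using reads_beforeD[OF y(2)] by simp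
        moreover have "e < r" using freeD[of r s e f] 4(1) rs' ef e idx' ab by simp
        ultimately show False using rc ab by simp
      next
        assume e: "ladder_index l (e, f) = ladder_index l (a, b) + int l"
        then have er: "e < r" using reads_beforeD[OF y(3)] up by simp
        moreover have "1 \<le> e" using is_partition_pos[OF p ef(1)] by simp
        ultimately obtain r' where r': "r = Suc r'" "1 \<le> r'" by (cases r) auto
        then have "(r', Suc s) \<in> lam" using True by simp
        moreover have "ladder_index l (e, f) = ladder_index l (r', Suc s) + 1"
          using e up unfolding r' ladder_index_Suc(1) by simp
        ultimately have "r' < e" using freeD[of e f r' "Suc s"] ef rs' r' by simp
        then show False using er r' by simp
      qed
    next
      \<comment> \<open>Otherwise both members move one row up, and both indices drop by
        one.\<close>
      case False
      then obtain r' where r': "r = Suc r'" "1 \<le> r'" using pos by (cases r) auto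
      then obtain a' where a': "a = Suc a'" "1 \<le> a'" using rc ab by (cases a) auto
      have "(r', s) \<in> lam" using is_partition_down[OF p 4(1), of r' s] pos r' by simp
      moreover have "(r', Suc s) \<notin> lam" using False r' by simp
      moreover have "(a', b) \<in> lam" "(Suc a', b) \<notin> lam" using xD a' by auto
      moreover have "ladder_index l (r', s) = ladder_index l (a', b) + 1"
        using idx' ab unfolding r' ab[symmetric] a' ladder_index_Suc by simp
      ultimately show False using freeD[of r' s a' b] rc ab r' a' by simp
    qed
  qed
qed

text \<open>Dual to insertion: \<open>between\<close> describes the leftmost surviving minus.
  Removal creates a forbidden pair only by vacating the position below \<open>(c, d)\<close> or by
  turning \<open>(r, s)\<close> into a row end. The pair then moves down or right to one forbidden
  in \<open>lam\<close>, or it exhibits an earlier removable box, and the addable position from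
  \<open>between\<close> leads to such a pair.\<close>

lemma ladder_free_remove:
  assumes l: "2 \<le> l" and p: "is_partition lam" and free: "ladder_free l lam"
    and x: "(a, b) \<in> removable l i lam"
    and between: "\<And>q. q \<in> removable l i lam \<Longrightarrow> reads_before l q (a, b) \<Longrightarrow>
      \<exists>y \<in> addable l i lam. reads_before l q y \<and> reads_before l y (a, b)"
  shows "ladder_free l (lam - {(a, b)})"
  unfolding ladder_free_def
proof (intro allI impI, rule ccontr)
  fix r s c d
  assume rs: "(r, s) \<in> lam - {(a, b)}" "(r, Suc s) \<notin> lam - {(a, b)}"
    and cd: "(c, d) \<in> lam - {(a, b)}" "(Suc c, d) \<notin> lam - {(a, b)}"
    and idx: "ladder_index l (r, s) = ladder_index l (Suc c, d)" and "\<not> c < r"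
  then have rc: "r \<le> c" by simp
  note xD = x[unfolded mem_removable_iff[OF p]]
  have xpos: "1 \<le> a" "1 \<le> b" using is_partition_pos[OF p, of a b] xD by auto
  note idx' = idx[unfolded ladder_index_Suc]
  note freeD = ladder_freeD[OF free, unfolded ladder_index_Suc]
  have rs': "(r, s) \<in> lam" and cd': "(c, d) \<in> lam" using rs cd by auto
  have rpos: "1 \<le> r" "1 \<le> s" and cpos: "1 \<le> c" "1 \<le> d"
    using is_partition_pos[OF p] rs' cd' by blast+
  consider "(r, Suc s) = (a, b)" "(Suc c, d) = (a, b)" | "(r, Suc s) \<notin> lam" "(Suc c, d) = (a, b)"
    | "(r, Suc s) \<notin> lam" "(Suc c, d) \<notin> lam" | "(r, Suc s) = (a, b)" "(Suc c, d) \<notin> lam"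
    using rs(2) cd(2) by blast
  then show False
  proof cases
    case 1
    then show False using rc by simp
  next
    case 2
    then have ab: "a = Suc c" "b = d" by auto
    have idx2: "ladder_index l (r, s) = ladder_index l (a, b)" using idx ab by simp
    show False
    \<comment> \<open>A box below \<open>(r, s)\<close> is again a row end, forbidden with the
      removed box. Otherwise \<open>(r, s)\<close> is removable, and the addable position read
      between it and \<open>(a, b)\<close> lies below row \<open>r\<close>, so it has a box above it
      and is a vacancy forbidden with \<open>(r, s)\<close>.\<close>
    proof (cases "(Suc r, s) \<in> lam")
      case True
      moreover have "(Suc r, Suc s) \<notin> lam"
        using is_partition_down[OF p, of "Suc r" "Suc s" r "Suc s"] rpos 2(1) by auto
      ultimately have "a < Suc r" using freeD[of "Suc r" s a b] xD idx2 by simp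
      then show False using ab rc by simp
    next
      case False
      have "residue l (a, b) = residue l (r, s)" unfolding residue_eq_iff using idx2 by simp
      then have "(r, s) \<in> removable l i lam"
        unfolding mem_removable_iff[OF p] using False 2(1) rs' xD by auto
      moreover have "reads_before l (r, s) (a, b)"
        by (rule reads_beforeI) (use idx2 ab rc xpos in \<open>auto simp del: ladder_index.simps\<close>)
      ultimately obtain e f where y: "(e, f) \<in> addable l i lam" "reads_before l (r, s) (e, f)"
        "reads_before l (e, f) (a, b)" using between by fastforce
      have e: "ladder_index l (e, f) = ladder_index l (r, s)" "r < e"
        using reads_beforeD[OF y(2)] reads_beforeD[OF y(3)] idx2 by auto
      then obtain e' where e': "e = Suc e'" "1 \<le> e'" using rpos by (cases e) auto
      have "(e', f) \<in> lam" "(Suc e', f) \<notin> lam" using y(1) e' unfolding mem_addable_iff[OF p] by auto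
      moreover have "ladder_index l (r, s) = ladder_index l (e', f) + 1"
        using e(1) unfolding e' ladder_index_Suc by simp
      ultimately show False using freeD[of r s e' f] rs' 2(1) e e' by simp
    qed
  next
    case 3
    then show False using freeD[of r s c d] rs' cd' idx' rc by simp
  next
    case 4
    then have ab: "a = r" "b = Suc s" by auto
    show False
    \<comment> \<open>The pair moves one column right if this box is present. Otherwise
      \<open>(c, d)\<close> is removable on the preceding ladder of residue \<open>i\<close>. An
      addable position in between is either on that ladder, a vacancy forbidden with the row end
      \<open>(c, d)\<close>, or on the ladder of \<open>(a, b)\<close>, where its left neighbour is
      a row end forbidden with \<open>(c, d)\<close>.\<close>
    proof (cases "(c, Suc d) \<in> lam")
      case True
      moreover have "(Suc c, Suc d) \<notin> lam"
        using is_partition_down[OF p, of "Suc c" "Suc d" "Suc c" d] cpos 4(2) by auto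
      moreover have "ladder_index l (a, b) = ladder_index l (c, Suc d) + 1"
        using idx' unfolding ab ladder_index_Suc by simp
      ultimately show False using freeD[of a b c "Suc d"] xD rc ab by simp
    next
      case False
      have up: "ladder_index l (a, b) = ladder_index l (c, d) + int l"
        using idx' unfolding ab ladder_index_Suc by simp
      then have res: "residue l (c, d) = residue l (a, b)" unfolding residue_eq_iff by simp
      then have "(c, d) \<in> removable l i lam"
        unfolding mem_removable_iff[OF p] using False 4(2) cd' xD by auto
      moreover have "reads_before l (c, d) (a, b)"
        by (rule reads_beforeI) (use up xpos l in \<open>auto simp del: ladder_index.simps\<close>)
      ultimately obtain e f where y: "(e, f) \<in> addable l i lam" "reads_before l (c, d) (e, f)"
        "reads_before l (e, f) (a, b)" using between by fastforce
      have ef: "(e, f) \<notin> lam" "1 \<le> e" "1 \<le> f" "residue l (c, d) = residue l (e, f)"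
        "e = 1 \<or> (e - 1, f) \<in> lam" "f = 1 \<or> (e, f - 1) \<in> lam"
        using y(1) xD res unfolding mem_addable_iff[OF p] by auto
      have "ladder_index l (e, f) = ladder_index l (c, d) \<or>
          ladder_index l (e, f) = ladder_index l (c, d) + int l"
        by (rule ladder_index_cases[OF ef(4)]) (use reads_beforeD[OF y(2)] reads_beforeD[OF y(3)] up in linarith)+
      then show False
      proof
        assume e: "ladder_index l (e, f) = ladder_index l (c, d)"
        then have ce: "c < e" using reads_beforeD[OF y(2)] by simp
        then obtain e' where e': "e = Suc e'" "1 \<le> e'" using cpos by (cases e) auto
        have "(e', f) \<in> lam" using ef e' by auto
        moreover have "ladder_index l (c, d) = ladder_index l (e', f) + 1"
          using e unfolding e' ladder_index_Suc by simp
        ultimately have "e' < c" using freeD[of c d e' f] cd' False ef e' by simp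
        then show False using ce e' by simp
      next
        assume e: "ladder_index l (e, f) = ladder_index l (c, d) + int l"
        then have ea: "e < a" using reads_beforeD[OF y(3)] up by simp
        have f1: "f \<noteq> 1"
        proof
          assume "f = 1"
          then have "int e = int a + (int l - 1) * (int b - 1)" using e up by simp
          moreover have "0 \<le> (int l - 1) * (int b - 1)" using l xpos by simp
          ultimately show False using ea by simp
        qed
        then obtain f' where f': "f = Suc f'" using ef by (cases f) auto
        have "(e, f') \<in> lam" "(e, Suc f') \<notin> lam" using ef f' f1 by auto
        moreover have "ladder_index l (e, f') = ladder_index l (c, d) + 1"
          using e unfolding f' ladder_index_Suc by simp
        ultimately have "c < e" using freeD[of e f' c d] cd' 4(2) by simp
        then show False using ea ab rc by simp
      qed
    qed
  qed
qed

section \<open>Cancellation in signature words\<close>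

lemma cancel_append: "cancel\<^sup>*\<^sup>* u u' \<Longrightarrow> cancel\<^sup>*\<^sup>* (s @ u @ t) (s @ u' @ t)"
proof (induction rule: rtranclp_induct)
  case (step y z)
  from step(2) have "cancel (s @ y @ t) (s @ z @ t)"
  proof cases
    case (1 u p q v)
    then show ?thesis using cancel.intros[of "s @ u" p q "v @ t"] by simp
  qed
  then show ?case using step.IH by (rule rtranclp.rtrancl_into_rtrancl[rotated])
qed simp

text \<open>Cancellation deletes adjacent letters only, so no cancelled pair straddles a surviving
  letter, and the words on its two sides reduce independently.\<close>

lemma cancel_split:
  assumes "cancel\<^sup>*\<^sup>* w (r1 @ z # r2)"
  shows "\<exists>u v. w = u @ z # v \<and> cancel\<^sup>*\<^sup>* u r1 \<and> cancel\<^sup>*\<^sup>* v r2"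
  using assms
proof (induction rule: converse_rtranclp_induct)
  case (step y w)
  obtain u v where w: "w = u @ z # v" and red: "cancel\<^sup>*\<^sup>* u r1" "cancel\<^sup>*\<^sup>* v r2"
    using step.IH by blast
  from step(1) show ?case
  proof cases
    case (1 s p q t)
    have "s @ t = u @ z # v" using 1 w by simp
    then consider us where "u = s @ us" "t = us @ z # v" | us where "s = u @ z # us" "v = us @ t"
      by (auto simp: append_eq_append_conv2 append_eq_Cons_conv Cons_eq_append_conv)
    then show ?thesis
    proof cases
      case us: 1
      then have "y = (s @ (Minus, p) # (Plus, q) # us) @ z # v" using 1 by simp
      moreover have "cancel (s @ (Minus, p) # (Plus, q) # us) u" using us cancel.intros by simp
      then have "cancel\<^sup>*\<^sup>* (s @ (Minus, p) # (Plus, q) # us) r1"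
        using red(1) by (rule converse_rtranclp_into_rtranclp)
      ultimately show ?thesis using red(2) by blast
    next
      case us: 2
      then have "y = u @ z # (us @ (Minus, p) # (Plus, q) # t)" using 1 by simp
      moreover have "cancel (us @ (Minus, p) # (Plus, q) # t) v" using us cancel.intros by simp
      then have "cancel\<^sup>*\<^sup>* (us @ (Minus, p) # (Plus, q) # t) r2"
        using red(2) by (rule converse_rtranclp_into_rtranclp)
      ultimately show ?thesis using red(1) by blast
    qed
  qed
qed blast

text \<open>A leading \<open>Plus\<close> has no \<open>Minus\<close> to its left, so no
  cancellation can delete it.\<close>

lemma cancel_starts_Plus:
  assumes "cancel\<^sup>*\<^sup>* w r" "w \<noteq> []" "fst (hd w) = Plus"
  shows "r \<noteq> [] \<and> fst (hd r) = Plus"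
  using assms(1)
proof (induction rule: rtranclp_induct)
  case (step y z)
  from step(2) show ?case
  proof cases
    case (1 u p q v)
    then show ?thesis using step.IH by (cases u) auto
  qed
qed (use assms in simp)

lemma cancel_ends_Minus:
  assumes "cancel\<^sup>*\<^sup>* w r" "w \<noteq> []" "fst (last w) = Minus"
  shows "r \<noteq> [] \<and> fst (last r) = Minus"
  using assms(1)
proof (induction rule: rtranclp_induct)
  case (step y z)
  from step(2) show ?case
  proof cases
    case (1 u p q v)
    then show ?thesis using step.IH by (cases v rule: rev_cases) auto
  qed
qed (use assms in simp)

text \<open>If no \<open>Minus\<close> preceded \<open>q\<close>, the word would begin with a
  \<open>Plus\<close>, and that letter would survive.\<close>

lemma cancel_Plus_preceded:
  assumes "cancel\<^sup>*\<^sup>* (v1 @ (Plus, q) # v2) r" "\<forall>z \<in> set r. fst z = Minus"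
  shows "\<exists>y. (Minus, y) \<in> set v1"
proof (rule ccontr)
  assume "\<not> ?thesis"
  then have "fst z = Plus" if "z \<in> set v1" for z using that by (cases z; cases "fst z") auto
  then have "fst (hd (v1 @ (Plus, q) # v2)) = Plus" by (cases v1) auto
  then show False using cancel_starts_Plus[OF assms(1)] assms(2) by auto
qed

lemma cancel_Minus_followed:
  assumes "cancel\<^sup>*\<^sup>* (u1 @ (Minus, q) # u2) r" "\<forall>z \<in> set r. fst z = Plus"
  shows "\<exists>y. (Plus, y) \<in> set u2"
proof (rule ccontr)
  assume "\<not> ?thesis"
  then have "fst z = Minus" if "z \<in> set u2" for z using that by (cases z; cases "fst z") auto
  then have "fst (last (u1 @ (Minus, q) # u2)) = Minus" by (cases u2 rule: rev_cases) auto
  then show False using cancel_ends_Minus[OF assms(1)] assms(2) by auto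
qed

lemma reduced_wordI:
  assumes "cancel\<^sup>*\<^sup>* w r" "\<nexists>r'. cancel r r'"
  shows "reduced_word w = r"
proof -
  have "strong_confluentp cancel" unfolding strong_confluentp_def using cancel_diamond by blast
  then have "confluentp cancel" by (rule strong_confluentp_imp_confluentp)
  then obtain t where "cancel\<^sup>*\<^sup>* (reduced_word w) t" "cancel\<^sup>*\<^sup>* r t"
    using confluentpD assms(1) reduced_word by metis
  then show ?thesis using assms(2) reduced_word[of w] by (metis converse_rtranclpE)
qed

text \<open>A \<open>Minus\<close> can occur only from the middle letter on, so its successor lies
  in \<open>r2\<close> and is no \<open>Plus\<close>. Leaving the sign \<open>s\<close> open lets
  the middle letter change sign without making the word reducible.\<close>

lemma cancel_irreducible:
  assumes "\<forall>z \<in> set r1. fst z = Plus" "\<forall>z \<in> set r2. fst z = Minus"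
  shows "\<nexists>r'. cancel (r1 @ (s, x) # r2) r'"
proof
  assume "\<exists>r'. cancel (r1 @ (s, x) # r2) r'"
  then obtain u p q v where e: "r1 @ (s, x) # r2 = u @ (Minus, p) # (Plus, q) # v"
    by (auto elim: cancel.cases)
  define n where "n = length u"
  have m: "n \<ge> length r1"
  proof (rule ccontr)
    assume "\<not> n \<ge> length r1"
    then have "(r1 @ (s, x) # r2) ! n \<in> set r1" by (simp add: nth_append)
    moreover have "(r1 @ (s, x) # r2) ! n = (Minus, p)" unfolding e n_def by simp
    ultimately show False using assms(1) by auto
  qed
  have "(r1 @ (s, x) # r2) ! Suc n = (Plus, q)" unfolding e n_def by (simp add: nth_append)
  moreover have "Suc n < length (r1 @ (s, x) # r2)" unfolding e n_def by simp
  then have "(r1 @ (s, x) # r2) ! Suc n \<in> set r2" using m by (simp add: nth_append Suc_diff_le)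
  ultimately show False using assms(2) by auto
qed

text \<open>The first \<open>Plus\<close> in \<open>r2\<close> would stand directly behind a
  \<open>Minus\<close> and could be cancelled with it.\<close>

lemma irreducible_Minus_tail:
  assumes "\<nexists>r'. cancel (r1 @ (Minus, x) # r2) r'"
  shows "\<forall>z \<in> set r2. fst z = Minus"
proof (rule ccontr)
  assume "\<not> ?thesis"
  then have "\<exists>z \<in> set r2. fst z \<noteq> Minus" by blast
  from split_list_first_prop[OF this]
  obtain s z t where st: "r2 = s @ z # t" "fst z \<noteq> Minus" "\<forall>y \<in> set s. \<not> fst y \<noteq> Minus" by blast
  obtain q where z: "z = (Plus, q)" using st(2) by (cases z; cases "fst z") auto
  obtain s' y where s': "(Minus, x) # s = s' @ [y]" by (cases "(Minus, x) # s" rule: rev_cases) auto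
  have "y \<in> set ((Minus, x) # s)" unfolding s' by simp
  then have "fst y = Minus" using st(3) by auto
  then obtain p where "y = (Minus, p)" by (metis prod.collapse)
  then have "r1 @ (Minus, x) # r2 = (r1 @ s') @ (Minus, p) # (Plus, q) # t"
    using s' st(1) z by (metis append.assoc append_Cons append_Nil)
  then show False using assms cancel.intros by metis
qed

section \<open>Signatures of partitions and the crystal operators\<close>

lemma set_ladder_signature:
  assumes "2 \<le> l" "is_partition lam"
  shows "(Plus, q) \<in> set (ladder_signature l i lam) \<longleftrightarrow> q \<in> addable l i lam"
    and "(Minus, q) \<in> set (ladder_signature l i lam) \<longleftrightarrow> q \<in> removable l i lam"
  unfolding ladder_signature_def set_map reading_list(2)[OF assms]
  by (auto simp: addable_def removable_def simp del: residue.simps)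

lemma ladder_signature_order:
  assumes "2 \<le> l" "is_partition lam" "ladder_signature l i lam = u @ z # v"
  shows "y \<in> set u \<Longrightarrow> reads_before l (snd y) (snd z)"
    and "y \<in> set v \<Longrightarrow> reads_before l (snd z) (snd y)"
proof -
  have "map snd (ladder_signature l i lam) = reading_list l i lam"
    unfolding ladder_signature_def by (simp add: comp_def)
  then have "sorted_wrt (reads_before l) (map snd (u @ z # v))"
    using reading_list(1)[OF assms(1,2)] assms(3) by metis
  then show "y \<in> set u \<Longrightarrow> reads_before l (snd y) (snd z)" "y \<in> set v \<Longrightarrow> reads_before l (snd z) (snd y)"
    by (auto simp: sorted_wrt_append)
qed

text \<open>The word behind the last surviving plus reduces to minuses alone. So each later plus has
  a minus between it and the added box, which is the hypothesis \<open>between\<close> of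
  \<open>ladder_free_insert\<close>.\<close>

lemma f_hat_ladder_free:
  assumes l: "2 \<le> l" and p: "is_partition lam" and free: "ladder_free l lam"
    and f: "f_hat l i lam = Some mu"
  shows "is_partition mu \<and> ladder_free l mu"
proof -
  let ?w = "ladder_signature l i lam"
  let ?ps = "filter (\<lambda>x. fst x = Plus) (reduced_word ?w)"
  have ne: "?ps \<noteq> []" and mu: "mu = insert (snd (last ?ps)) lam"
    using f by (auto simp: f_hat_def Let_def split: if_splits)
  have "\<exists>z \<in> set (reduced_word ?w). fst z = Plus" using ne by (auto simp: filter_empty_conv)
  from split_list_last_prop[OF this]
  obtain r1 z r2 where r: "reduced_word ?w = r1 @ z # r2" "fst z = Plus" "\<forall>y \<in> set r2. fst y \<noteq> Plus"
    by blast
  obtain x where z: "z = (Plus, x)" using r(2) by (cases z) auto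
  have "filter (\<lambda>x. fst x = Plus) r2 = []" using r(3) by (simp add: filter_empty_conv)
  then have "last ?ps = (Plus, x)" using r(1) z by simp
  then have mux: "mu = insert x lam" using mu by simp
  have r2: "\<forall>y \<in> set r2. fst y = Minus" using r(3) sign.exhaust by blast
  have "cancel\<^sup>*\<^sup>* ?w (r1 @ (Plus, x) # r2)" using reduced_word[of ?w] r(1) z by simp
  then obtain u v where w: "?w = u @ (Plus, x) # v" and v: "cancel\<^sup>*\<^sup>* v r2"
    using cancel_split by blast
  note ord = ladder_signature_order[OF l p]
  have xa: "x \<in> addable l i lam" using set_ladder_signature(1)[OF l p, of x i] w by simp
  obtain a b where ab: "x = (a, b)" by (cases x)
  have "ladder_free l (insert (a, b) lam)"
  proof (rule ladder_free_insert[OF l p free])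
    show "(a, b) \<in> addable l i lam" using xa ab by simp
    fix q assume q: "q \<in> addable l i lam" "reads_before l (a, b) q"
    have "(Plus, q) \<in> set ?w" using set_ladder_signature(1)[OF l p] q(1) by blast
    moreover have "(Plus, q) \<notin> set u" "q \<noteq> x"
      using ord(1)[OF w, of "(Plus, q)"] q(2) ab reads_before_asym[of l "(a, b)" q] by auto
    ultimately have "(Plus, q) \<in> set v" using w by auto
    then obtain v1 v2 where v12: "v = v1 @ (Plus, q) # v2" by (meson split_list)
    then obtain y where y: "(Minus, y) \<in> set v1" using cancel_Plus_preceded v r2 by blast
    have "y \<in> removable l i lam" using set_ladder_signature(2)[OF l p, of y i] w v12 y by simp
    moreover have "reads_before l (a, b) y" using ord(2)[OF w, of "(Minus, y)"] v12 y ab by simp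
    moreover have "?w = (u @ (Plus, x) # v1) @ (Plus, q) # v2" using w v12 by simp
    then have "reads_before l y q" using ord(1)[of i _ "(Plus, q)" v2 "(Minus, y)"] y by fastforce
    ultimately show "\<exists>y \<in> removable l i lam. reads_before l (a, b) y \<and> reads_before l y q" by blast
  qed
  moreover have "is_partition mu" using xa mux by (simp add: addable_def)
  ultimately show ?thesis using mux ab by simp
qed

text \<open>The neighbours of a position of residue \<open>i\<close> have other residues and so
  differ from \<open>x\<close>; only the status of \<open>x\<close> itself changes.\<close>

lemma remove_addable_removable:
  assumes l: "2 \<le> l" and p: "is_partition lam" and x: "x \<in> removable l i lam"
  shows "addable l i (lam - {x}) = insert x (addable l i lam)"
    and "removable l i (lam - {x}) = removable l i lam - {x}"
proof -
  obtain a b where ab: "x = (a, b)" by (cases x)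
  have p': "is_partition (lam - {x})" using x by (simp add: removable_def)
  note xD = x[unfolded ab mem_removable_iff[OF p]]
  have xpos: "1 \<le> a" "1 \<le> b" using is_partition_pos[OF p, of a b] xD by auto
  have neq: "(Suc c, d) \<noteq> x" "(c, Suc d) \<noteq> x" if "residue l (c, d) = int i" for c d
    using residue_Suc_neq[OF l, of c d] that xD ab by (auto simp del: residue.simps)
  \<comment> \<open>The condition \<open>(c, d) \<noteq> x\<close> covers truncated subtraction: for
    \<open>c = 0\<close> or \<open>d = 0\<close> the predecessor is the position itself.\<close>
  have neq': "(c - 1, d) \<noteq> x" "(c, d - 1) \<noteq> x" if "residue l (c, d) = int i" "(c, d) \<noteq> x" for c d
  proof -
    show "(c - 1, d) \<noteq> x" using residue_Suc_neq(1)[OF l, of "c - 1" d] that xD ab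
      by (cases c) (auto simp del: residue.simps)
    show "(c, d - 1) \<noteq> x" using residue_Suc_neq(2)[OF l, of c "d - 1"] that xD ab
      by (cases d) (auto simp del: residue.simps)
  qed
  show "removable l i (lam - {x}) = removable l i lam - {x}"
  proof (rule set_eqI)
    fix q :: position obtain c d where q: "q = (c, d)" by (cases q)
    show "q \<in> removable l i (lam - {x}) \<longleftrightarrow> q \<in> removable l i lam - {x}"
      unfolding q mem_removable_iff[OF p'] Diff_iff mem_removable_iff[OF p] using neq[of c d] by blast
  qed
  show "addable l i (lam - {x}) = insert x (addable l i lam)"
  proof (rule set_eqI)
    fix q :: position obtain c d where q: "q = (c, d)" by (cases q)
    show "q \<in> addable l i (lam - {x}) \<longleftrightarrow> q \<in> insert x (addable l i lam)"
    proof (cases "q = x")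
      case True
      have "insert x (lam - {x}) = lam" using xD ab by auto
      then have "x \<in> addable l i (lam - {x})" using p xD ab by (simp add: addable_def)
      then show ?thesis using True by simp
    next
      case False
      then show ?thesis
        unfolding q insert_iff mem_addable_iff[OF p'] mem_addable_iff[OF p] using neq'[of c d] by blast
    qed
  qed
qed

text \<open>As \<open>x\<close> passes from removable to addable, the union of the two sets stays
  fixed, so both diagrams have the same reading list.\<close>

lemma ladder_signature_remove:
  assumes l: "2 \<le> l" and p: "is_partition lam" and w: "ladder_signature l i lam = u @ (Minus, x) # v"
  shows "ladder_signature l i (lam - {x}) = u @ (Plus, x) # v"
proof -
  have x: "x \<in> removable l i lam" using set_ladder_signature(2)[OF l p, of x i] w by simp
  note ar = remove_addable_removable[OF l p x]
  have "addable l i (lam - {x}) \<union> removable l i (lam - {x}) = addable l i lam \<union> removable l i lam"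
    using ar x by auto
  then have rl: "reading_list l i (lam - {x}) = reading_list l i lam" by (simp add: reading_list_def)
  let ?F = "\<lambda>p. (if p \<in> addable l i lam then Plus else Minus, p)"
  let ?G = "\<lambda>p. (if p \<in> addable l i (lam - {x}) then Plus else Minus, p)"
  obtain ps1 ps2 where ps: "reading_list l i lam = ps1 @ x # ps2" "u = map ?F ps1" "v = map ?F ps2"
    using w unfolding ladder_signature_def by (fastforce simp: map_eq_append_conv map_eq_Cons_conv)
  have "sorted_wrt (reads_before l) (ps1 @ x # ps2)" using reading_list(1)[OF l p, of i] ps(1) by simp
  then have "x \<notin> set ps1" "x \<notin> set ps2"
    using reads_before_asym[of l x x] by (auto simp: sorted_wrt_append)
  then have "map ?G ps1 = u" "map ?G ps2 = v" using ar(1) ps by auto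
  then show ?thesis unfolding ladder_signature_def rl ps(1) using ar(1) by simp
qed

text \<open>A removable box on the rightmost occupied ladder ensures that some minus survives. The
  box taken away is that of the leftmost surviving minus: with its sign reversed, this letter is the
  rightmost surviving plus, so \<open>f_hat\<close> puts the box back.\<close>

lemma ladder_free_predecessor:
  assumes l: "2 \<le> l" and p: "is_partition lam" and free: "ladder_free l lam" and "lam \<noteq> {}"
  shows "\<exists>i x. i < l \<and> x \<in> removable l i lam \<and> ladder_free l (lam - {x}) \<and>
    f_hat l i (lam - {x}) = Some lam"
proof -
  let ?I = "ladder_index l ` lam"
  have I: "finite ?I" "?I \<noteq> {}" using is_partition_finite[OF p] assms(4) by auto
  obtain x where x: "x \<in> lam" "ladder_index l x = Max ?I" using Max_in[OF I] by (metis imageE)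
  obtain a b where "x = (a, b)" by (cases x)
  then have ab: "(a, b) \<in> lam" "\<And>q. q \<in> lam \<Longrightarrow> ladder_index l q \<le> ladder_index l (a, b)"
    using x Max_ge[OF I(1) imageI[of _ lam "ladder_index l"]] by (simp_all del: ladder_index.simps)
  define i where "i = nat (residue l (a, b))"
  have i: "residue l (a, b) = int i" "i < l" using l by (auto simp: i_def nat_less_iff)
  have about: "(Suc a, b) \<notin> lam" "(a, Suc b) \<notin> lam"
    using ab(2)[of "(Suc a, b)"] ab(2)[of "(a, Suc b)"] l unfolding ladder_index_Suc by auto
  have rem: "(a, b) \<in> removable l i lam" unfolding mem_removable_iff[OF p] using ab(1) about i by blast
  have no_later: "\<not> reads_before l (a, b) q" if q: "q \<in> addable l i lam" for q
  proof
    assume rb: "reads_before l (a, b) q"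
    obtain e f where ef: "q = (e, f)" by (cases q)
    note D = q[unfolded ef mem_addable_iff[OF p]]
    have res: "residue l (a, b) = residue l (e, f)" using D i by simp
    \<comment> \<open>An addable position is one step below or right of a box, which raises the
      index by \<open>1\<close> or \<open>l - 1\<close>; from the maximal index this does not reach
      the next ladder of the same residue. The corner \<open>(1, 1)\<close> is already
      occupied.\<close>
    have big: "ladder_index l (e, f) < ladder_index l (a, b) + int l"
    proof (cases "e = 1")
      case False
      then obtain e' where "e = Suc e'" "(e', f) \<in> lam" using D by (cases e) auto
      then show ?thesis using ab(2)[of "(e', f)"] l unfolding \<open>e = Suc e'\<close> ladder_index_Suc by linarith
    next
      case True
      show ?thesis
      proof (cases "f = 1")
        case False
        then obtain f' where "f = Suc f'" "(e, f') \<in> lam" using D by (cases f) auto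
        then show ?thesis using ab(2)[of "(e, f')"] l unfolding \<open>f = Suc f'\<close> ladder_index_Suc by linarith
      next
        case f1: True
        have "1 \<le> a" "1 \<le> b" using is_partition_pos[OF p ab(1)] by auto
        then have "(1, 1) \<in> lam" using is_partition_down[OF p ab(1)] by simp
        then show ?thesis using D True f1 by simp
      qed
    qed
    \<comment> \<open>Equal residues leave only the ladder of \<open>(a, b)\<close> itself; the box
      above \<open>(e, f)\<close> and the row end \<open>(a, b)\<close> then contradict
      \<open>free\<close>.\<close>
    have "ladder_index l (e, f) = ladder_index l (a, b)" "a < e"
      using reads_beforeD[OF rb] ladder_index_cases[OF res] big ef by auto
    moreover obtain e' where e': "e = Suc e'" using \<open>a < e\<close> by (cases e) auto
    moreover have "(e', f) \<in> lam" using D is_partition_pos[OF p ab(1)] \<open>a < e\<close> e' by auto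
    ultimately show False using ladder_freeD[OF free ab(1) about(2), of e' f] D by auto
  qed
  let ?w = "ladder_signature l i lam"
  have "(Minus, (a, b)) \<in> set ?w" using rem set_ladder_signature(2)[OF l p] by blast
  then obtain w1 w2 where w12: "?w = w1 @ (Minus, (a, b)) # w2" by (meson split_list)
  have "fst z = Minus" if "z \<in> set w2" for z
  proof (rule ccontr)
    assume "fst z \<noteq> Minus"
    then obtain q where "z = (Plus, q)" by (cases z; cases "fst z") auto
    then show False
      using ladder_signature_order(2)[OF l p w12 that] no_later set_ladder_signature(1)[OF l p, of q i] w12 that
      by auto
  qed
  then have "fst (last ?w) = Minus" unfolding w12 by (cases w2 rule: rev_cases) auto
  then have "reduced_word ?w \<noteq> []" "fst (last (reduced_word ?w)) = Minus"
    using cancel_ends_Minus[of ?w "reduced_word ?w"] reduced_word[of ?w] w12 by auto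
  then have "\<exists>z \<in> set (reduced_word ?w). fst z = Minus" using last_in_set by blast
  from split_list_first_prop[OF this]
  obtain r1 z r2 where r: "reduced_word ?w = r1 @ z # r2" "fst z = Minus" "\<forall>y \<in> set r1. fst y \<noteq> Minus"
    by blast
  obtain x where z: "z = (Minus, x)" using r(2) by (cases z) auto
  have r1: "\<forall>y \<in> set r1. fst y = Plus" using r(3) sign.exhaust by blast
  have r2: "\<forall>y \<in> set r2. fst y = Minus"
    using irreducible_Minus_tail[of r1 x r2] reduced_word[of ?w] r(1) z by simp
  have "cancel\<^sup>*\<^sup>* ?w (r1 @ (Minus, x) # r2)" using reduced_word[of ?w] r(1) z by simp
  then obtain u v where w: "?w = u @ (Minus, x) # v" and uv: "cancel\<^sup>*\<^sup>* u r1" "cancel\<^sup>*\<^sup>* v r2"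
    using cancel_split by blast
  note ord = ladder_signature_order[OF l p]
  have xr: "x \<in> removable l i lam" using set_ladder_signature(2)[OF l p, of x i] w by simp
  obtain c d where cd: "x = (c, d)" by (cases x)
  have "ladder_free l (lam - {(c, d)})"
  proof (rule ladder_free_remove[OF l p free])
    show "(c, d) \<in> removable l i lam" using xr cd by simp
    fix q assume q: "q \<in> removable l i lam" "reads_before l q (c, d)"
    have "(Minus, q) \<in> set ?w" using set_ladder_signature(2)[OF l p] q(1) by blast
    moreover have "(Minus, q) \<notin> set v" "q \<noteq> x"
      using ord(2)[OF w, of "(Minus, q)"] q(2) cd reads_before_asym[of l q "(c, d)"] by auto
    ultimately have "(Minus, q) \<in> set u" using w by auto
    then obtain u1 u2 where u12: "u = u1 @ (Minus, q) # u2" by (meson split_list)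
    then obtain y where y: "(Plus, y) \<in> set u2" using cancel_Minus_followed uv(1) r1 by blast
    have "y \<in> addable l i lam" using set_ladder_signature(1)[OF l p, of y i] w u12 y by simp
    moreover have "reads_before l y (c, d)" using ord(1)[OF w, of "(Plus, y)"] u12 y cd by simp
    moreover have "?w = u1 @ (Minus, q) # (u2 @ (Minus, x) # v)" using w u12 by simp
    then have "reads_before l q y" using ord(2)[of i u1 "(Minus, q)" _ "(Plus, y)"] y by fastforce
    ultimately show "\<exists>y \<in> addable l i lam. reads_before l q y \<and> reads_before l y (c, d)" by blast
  qed
  \<comment> \<open>Since \<open>x\<close> survives in the signature of \<open>lam\<close>, the
    reductions on its two sides do not involve it and remain valid with its sign reversed.\<close>
  moreover have "f_hat l i (lam - {x}) = Some lam"
  proof -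
    have "cancel\<^sup>*\<^sup>* (u @ (Plus, x) # v) (r1 @ (Plus, x) # v)"
      using cancel_append[OF uv(1), of "[]" "(Plus, x) # v"] by simp
    also have "cancel\<^sup>*\<^sup>* (r1 @ (Plus, x) # v) (r1 @ (Plus, x) # r2)"
      using cancel_append[OF uv(2), of "r1 @ [(Plus, x)]" "[]"] by simp
    finally have "reduced_word (ladder_signature l i (lam - {x})) = r1 @ (Plus, x) # r2"
      unfolding ladder_signature_remove[OF l p w]
      by (rule reduced_wordI) (rule cancel_irreducible[OF r1 r2])
    moreover have "filter (\<lambda>x. fst x = Plus) r2 = []" using r2 by (simp add: filter_empty_conv)
    moreover have "insert x lam = lam" using xr by (auto simp: removable_def)
    ultimately show ?thesis by (simp add: f_hat_def)
  qed
  ultimately show ?thesis using i(2) xr cd by blast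
qed

theorem theorem3p11p2p3:
  fixes l :: nat and lam :: "position set"
  assumes "l \<ge> 3" and "is_partition lam"
  shows "lam \<in> ladder_crystal l \<longleftrightarrow>
    \<not> (\<exists>(i, j) \<in> lam. hook_length lam (i, j) = l * arm lam (i, j))"
proof -
  have l: "2 \<le> l" using assms(1) by simp
  have "lam \<in> ladder_crystal l \<longleftrightarrow> ladder_free l lam"
  proof
    assume "lam \<in> ladder_crystal l"
    then have "is_partition lam \<and> ladder_free l lam"
    proof induction
      case empty
      show ?case using is_partition_empty by (simp add: ladder_free_def)
    next
      case (step lam i mu)
      then show ?case using f_hat_ladder_free[OF l] by blast
    qed
    then show "ladder_free l lam" ..
  next
    assume "ladder_free l lam"
    with assms(2) show "lam \<in> ladder_crystal l"
    proof (induction "card lam" arbitrary: lam rule: less_induct)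
      case less
      show ?case
      proof (cases "lam = {}")
        case False
        then obtain i x where x: "i < l" "x \<in> removable l i lam" "ladder_free l (lam - {x})"
            "f_hat l i (lam - {x}) = Some lam"
          using ladder_free_predecessor[OF l less.prems] by blast
        have xl: "x \<in> lam" "is_partition (lam - {x})" using x(2) by (auto simp: removable_def)
        have "card (lam - {x}) < card lam"
          by (rule card_Diff1_less[OF is_partition_finite[OF less.prems(1)] xl(1)])
        then have "lam - {x} \<in> ladder_crystal l" using less.hyps xl(2) x(3) by blast
        then show ?thesis using x(1,4) by (rule ladder_crystal.step)
      qed (simp add: ladder_crystal.empty)
    qed
  qed
  then show ?thesis using ladder_free_iff_hook[OF l assms(2)] by simp
qed

end
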